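(* Let $(A,d)$ be a differential graded algebra. Then $(A,d)$ is a dg-division algebra if and only if the graded ring $\ker(d)$ is a $\mathbb{Z}$-graded-division ring.
   Context: Let $K$ be a commutative ring. A differential graded $K$-algebra (dg-algebra) $(A,d)$ is a $\mathbb{Z}$-graded unital associative $K$-algebra $A$ together with a $K$-linear graded endomorphism $d:A\to A$ of degree $1$ such that $d^2=0$ and $d(ab)=d(a)b+(-1)^{|a|}a\,d(b)$ for all homogeneous $a,b\in A$, where $|a|$ is the degree of $a$. The kernel $\ker(d)$ is a graded subring of $A$. A dg-left (resp. dg-right) ideal of $(A,d)$ is a graded left (resp. right) ideal $I$ of $A$ with $d(I)\subseteq I$. A dg-division algebra (also called dg-division ring) is a dg-algebra $(A,d)$ such that the only dg-left ideals are $0$ and $A$ and the only dg-right ideals are $0$ and $A$. Dg-division algebras are understood to be nonzero. A $\mathbb{Z}$-graded-division ring is a nonzero $\mathbb{Z}$-graded ring in which every nonzero homogeneous element is invertible. *)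

theory Defs
  imports "HOL-Algebra.Algebra"
begin

text \<open>A family of subsets indexed by the integers stands for a grading. The function \<open>f\<close> gives the
  homogeneous components of \<open>a\<close>. Finiteness of the support has to be required explicitly, because
  \<^const>\<open>finsum\<close> over an infinite index set is \<open>\<zero>\<close>.\<close>

definition homogeneous_components ::
    "('a, 'm) ring_scheme \<Rightarrow> (int \<Rightarrow> 'a set) \<Rightarrow> 'a \<Rightarrow> (int \<Rightarrow> 'a) \<Rightarrow> bool" where
  "homogeneous_components R G a f \<longleftrightarrow>
     (\<forall>i. f i \<in> G i) \<and> finite {i. f i \<noteq> \<zero>\<^bsub>R\<^esub>} \<and>
     a = (\<Oplus>\<^bsub>R\<^esub>i\<in>{i. f i \<noteq> \<zero>\<^bsub>R\<^esub>}. f i)"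

text \<open>The additive subgroup \<open>M\<close> of \<open>R\<close> is the internal direct sum of the subgroups \<open>G i\<close>.\<close>

definition internal_direct_sum ::
    "('a, 'm) ring_scheme \<Rightarrow> (int \<Rightarrow> 'a set) \<Rightarrow> 'a set \<Rightarrow> bool" where
  "internal_direct_sum R G M \<longleftrightarrow>
     (\<forall>i. additive_subgroup (G i) R \<and> G i \<subseteq> M) \<and>
     (\<forall>a\<in>M. \<exists>!f. homogeneous_components R G a f)"

locale graded_ring = ring R for R (structure) +
  fixes G :: "int \<Rightarrow> 'a set"
  assumes direct_sum: "internal_direct_sum R G (carrier R)"
    and one_graded: "\<one> \<in> G 0"
    and mult_graded: "x \<in> G i \<Longrightarrow> y \<in> G j \<Longrightarrow> x \<otimes> y \<in> G (i + j)"

locale graded_division_ring = graded_ring +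
  assumes nonzero: "carrier R \<noteq> {\<zero>}"
    and homogeneous_Units: "x \<in> G i \<Longrightarrow> x \<noteq> \<zero> \<Longrightarrow> x \<in> Units R"

text \<open>The library locale \<^locale>\<open>algebra\<close> is restricted to commutative algebras, so bilinearity of the
  multiplication over \<open>K\<close> is spelled out here.\<close>

locale graded_algebra = module K A + graded_ring A G
    for K and A (structure) and G +
  assumes smult_mult_left:
      "k \<in> carrier K \<Longrightarrow> x \<in> carrier A \<Longrightarrow> y \<in> carrier A \<Longrightarrow> (k \<odot> x) \<otimes> y = k \<odot> (x \<otimes> y)"
    and smult_mult_right:
      "k \<in> carrier K \<Longrightarrow> x \<in> carrier A \<Longrightarrow> y \<in> carrier A \<Longrightarrow> x \<otimes> (k \<odot> y) = k \<odot> (x \<otimes> y)"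
    and submodule_graded: "submodule (G i) K A"

locale dg_algebra = graded_algebra K A G
    for K and A (structure) and G +
  fixes d :: "'c \<Rightarrow> 'c"
  assumes diff_closed: "x \<in> carrier A \<Longrightarrow> d x \<in> carrier A"
    and diff_add: "x \<in> carrier A \<Longrightarrow> y \<in> carrier A \<Longrightarrow> d (x \<oplus> y) = d x \<oplus> d y"
    and diff_smult: "k \<in> carrier K \<Longrightarrow> x \<in> carrier A \<Longrightarrow> d (k \<odot> x) = k \<odot> d x"
    and diff_degree: "x \<in> G i \<Longrightarrow> d x \<in> G (i + 1)"
    and diff_diff: "x \<in> carrier A \<Longrightarrow> d (d x) = \<zero>"
    and diff_mult: "x \<in> G i \<Longrightarrow> y \<in> G j \<Longrightarrow>
      d (x \<otimes> y) = d x \<otimes> y \<oplus> (if even i then x \<otimes> d y else \<ominus> (x \<otimes> d y))"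

definition dg_left_ideal ::
    "('a, 'm) ring_scheme \<Rightarrow> (int \<Rightarrow> 'a set) \<Rightarrow> ('a \<Rightarrow> 'a) \<Rightarrow> 'a set \<Rightarrow> bool" where
  "dg_left_ideal A G d I \<longleftrightarrow>
     additive_subgroup I A \<and> (\<forall>a\<in>carrier A. \<forall>x\<in>I. a \<otimes>\<^bsub>A\<^esub> x \<in> I) \<and>
     internal_direct_sum A (\<lambda>i. I \<inter> G i) I \<and> d ` I \<subseteq> I"

definition dg_right_ideal ::
    "('a, 'm) ring_scheme \<Rightarrow> (int \<Rightarrow> 'a set) \<Rightarrow> ('a \<Rightarrow> 'a) \<Rightarrow> 'a set \<Rightarrow> bool" where
  "dg_right_ideal A G d I \<longleftrightarrow>
     additive_subgroup I A \<and> (\<forall>a\<in>carrier A. \<forall>x\<in>I. x \<otimes>\<^bsub>A\<^esub> a \<in> I) \<and>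
     internal_direct_sum A (\<lambda>i. I \<inter> G i) I \<and> d ` I \<subseteq> I"

locale dg_division_algebra = dg_algebra +
  assumes nonzero: "carrier A \<noteq> {\<zero>}"
    and dg_left_ideals: "dg_left_ideal A G d I \<Longrightarrow> I = {\<zero>} \<or> I = carrier A"
    and dg_right_ideals: "dg_right_ideal A G d I \<Longrightarrow> I = {\<zero>} \<or> I = carrier A"

text \<open>The kernel of \<open>d\<close> as a ring, with the operations of \<open>A\<close>; its degree \<open>i\<close> part is
  \<open>a_kernel A A d \<inter> G i\<close>.\<close>

abbreviation kernel_ring :: "('a, 'm) ring_scheme \<Rightarrow> ('a \<Rightarrow> 'a) \<Rightarrow> ('a, 'm) ring_scheme" where
  "kernel_ring A d \<equiv> A\<lparr>carrier := a_kernel A A d\<rparr>"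

end

theory Submission
  imports Defs
begin

text \<open>Two observations carry the proof. First, if \<open>x\<close> is a homogeneous cycle, then the Leibniz rule
  reduces to \<open>d (a x) = (d a) x\<close> and \<open>d (x a) = \<plusminus> x (d a)\<close>, so that \<open>A x\<close> and \<open>x A\<close> are a dg-left and a
  dg-right ideal. In a dg-division algebra both are \<open>A\<close> as soon as \<open>x \<noteq> 0\<close>, so \<open>x\<close> is invertible, and
  its inverse \<open>y\<close> is again a cycle because \<open>(d y) x = d (y x) = d 1 = 0\<close>.

  Second, a nonzero dg-ideal \<open>I\<close> always contains a nonzero homogeneous cycle: take a nonzero
  homogeneous \<open>x \<in> I\<close>; then either \<open>d x = 0\<close> and \<open>x\<close> itself will do, or \<open>d x\<close> is such a cycle. If the
  nonzero homogeneous cycles are invertible, \<open>I\<close> contains a unit and is all of \<open>A\<close>.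

  What remains is that the kernel is a graded ring and that \<open>A x\<close> and \<open>x A\<close> are graded. The maps \<open>d\<close>,
  \<open>a \<mapsto> a x\<close> and \<open>a \<mapsto> x a\<close> all are additive and shift the degree by a constant, and
  the kernel and the image of any such map are spanned by their homogeneous elements.\<close>

section \<open>Graded subgroups and graded subrings\<close>

context graded_ring
begin

lemma graded_part_subgroup: "additive_subgroup (G i) R"
  using direct_sum by (simp add: internal_direct_sum_def)

lemma graded_part_closed: "x \<in> G i \<Longrightarrow> x \<in> carrier R"
  using direct_sum unfolding internal_direct_sum_def by blast

lemma components_exist: "a \<in> carrier R \<Longrightarrow> \<exists>f. homogeneous_components R G a f"
  using direct_sum unfolding internal_direct_sum_def by blast

lemma components_unique:
  "a \<in> carrier R \<Longrightarrow> homogeneous_components R G a f \<Longrightarrow> homogeneous_components R G a g \<Longrightarrow> f = g"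
  using direct_sum unfolding internal_direct_sum_def by blast

lemma components_zero: "homogeneous_components R G \<zero> (\<lambda>i. \<zero>)"
  using additive_subgroup.zero_closed[OF graded_part_subgroup]
  by (simp add: homogeneous_components_def)

lemma components_induct [consumes 1, case_names zero add component]:
  assumes a: "homogeneous_components R G a f"
    and zero: "P \<zero>"
    and add: "\<And>x y. x \<in> carrier R \<Longrightarrow> y \<in> carrier R \<Longrightarrow> P x \<Longrightarrow> P y \<Longrightarrow> P (x \<oplus> y)"
    and component: "\<And>i. P (f i)"
  shows "P a"
proof -
  have f: "f i \<in> carrier R" for i
    using a graded_part_closed by (auto simp: homogeneous_components_def)
  have "P (\<Oplus>i\<in>S. f i)" if "finite S" for S
    using that
  proof induction
    case empty
    then show ?case using zero by simp
  next
    case (insert i S)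
    then have "(\<Oplus>k\<in>insert i S. f k) = f i \<oplus> (\<Oplus>k\<in>S. f k)"
      using f by (intro finsum_insert) auto
    then show ?case
      using insert.IH add component f by (simp add: finsum_closed Pi_I)
  qed
  then show ?thesis
    using a by (simp add: homogeneous_components_def)
qed

lemma homogeneous_induct [consumes 1, case_names zero add homogeneous]:
  assumes "a \<in> carrier R"
    and "P \<zero>"
    and "\<And>x y. x \<in> carrier R \<Longrightarrow> y \<in> carrier R \<Longrightarrow> P x \<Longrightarrow> P y \<Longrightarrow> P (x \<oplus> y)"
    and "\<And>i x. x \<in> G i \<Longrightarrow> P x"
  shows "P a"
proof -
  obtain f where f: "homogeneous_components R G a f"
    using components_exist assms(1) by blast
  then have "P (f i)" for i
    using assms(4) by (auto simp: homogeneous_components_def)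
  then show ?thesis
    using components_induct[OF f, of P] assms(2,3) by blast
qed

text \<open>Uniqueness of the components is inherited from \<open>R\<close>; only their membership in \<open>M\<close> is at stake.\<close>

lemma graded_subgroupI:
  assumes M: "additive_subgroup M R"
    and components: "\<And>a. a \<in> M \<Longrightarrow> \<exists>f. homogeneous_components R G a f \<and> (\<forall>i. f i \<in> M)"
  shows "internal_direct_sum R (\<lambda>i. M \<inter> G i) M"
  unfolding internal_direct_sum_def
proof (intro conjI allI ballI)
  fix i
  show "additive_subgroup (M \<inter> G i) R"
    using add.subgroups_Inter_pair[OF additive_subgroup.a_subgroup[OF M]
        additive_subgroup.a_subgroup[OF graded_part_subgroup]]
    by (rule additive_subgroup.intro)
  show "M \<inter> G i \<subseteq> M" by blast
next
  fix a assume a: "a \<in> M"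
  have "homogeneous_components R (\<lambda>i. M \<inter> G i) a f \<longleftrightarrow>
      homogeneous_components R G a f \<and> (\<forall>i. f i \<in> M)" for f
    by (auto simp: homogeneous_components_def)
  then show "\<exists>!f. homogeneous_components R (\<lambda>i. M \<inter> G i) a f"
    using components[OF a] components_unique additive_subgroup.a_Hcarr[OF M a] by metis
qed

lemma graded_subgroup_nonzero_homogeneous:
  assumes M: "internal_direct_sum R (\<lambda>i. M \<inter> G i) M"
    and "M \<noteq> {\<zero>}" "\<zero> \<in> M"
  obtains x i where "x \<in> M" "x \<in> G i" "x \<noteq> \<zero>"
proof -
  obtain a where a: "a \<in> M" "a \<noteq> \<zero>"
    using assms(2,3) by blast
  then obtain f where f: "homogeneous_components R (\<lambda>i. M \<inter> G i) a f"
    using M unfolding internal_direct_sum_def by blast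
  have "\<exists>i. f i \<noteq> \<zero>"
  proof (rule ccontr)
    assume "\<nexists>i. f i \<noteq> \<zero>"
    then show False using f a(2) by (simp add: homogeneous_components_def)
  qed
  then show thesis
    using f that by (auto simp: homogeneous_components_def)
qed

end

lemma (in ring) finsum_subring:
  assumes H: "subring H R" and f: "\<And>i. i \<in> S \<Longrightarrow> f i \<in> H"
  shows "(\<Oplus>\<^bsub>R\<lparr>carrier := H\<rparr>\<^esub>i\<in>S. f i) = (\<Oplus>i\<in>S. f i)"
proof -
  interpret H: ring "R\<lparr>carrier := H\<rparr>"
    by (rule subring_is_ring[OF H])
  show ?thesis
    using f
  proof (induction S rule: infinite_finite_induct)
    case (infinite S)
    then show ?case by (simp add: finsum_infinite H.finsum_infinite)
  next
    case empty
    then show ?case by simp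
  next
    case (insert i S)
    then have "f \<in> S \<rightarrow> carrier R" "f i \<in> carrier R"
      using subringE(1)[OF H] by auto
    then show ?case
      using insert by (simp add: H.finsum_insert finsum_insert)
  qed
qed

lemma (in graded_ring) graded_subring:
  assumes H: "subring H R" and graded: "internal_direct_sum R (\<lambda>i. H \<inter> G i) H"
  shows "graded_ring (R\<lparr>carrier := H\<rparr>) (\<lambda>i. H \<inter> G i)"
proof -
  interpret H: ring "R\<lparr>carrier := H\<rparr>"
    by (rule subring_is_ring[OF H])
  have components: "homogeneous_components (R\<lparr>carrier := H\<rparr>) (\<lambda>i. H \<inter> G i) a f \<longleftrightarrow>
      homogeneous_components R (\<lambda>i. H \<inter> G i) a f" for a f
    using finsum_subring[OF H, of "{i. f i \<noteq> \<zero>}" f]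
    by (auto simp: homogeneous_components_def)
  have subgroup: "additive_subgroup (H \<inter> G i) (R\<lparr>carrier := H\<rparr>)" for i
  proof -
    have "subgroup (H \<inter> G i) (add_monoid R)"
      using graded by (auto simp: internal_direct_sum_def additive_subgroup_def)
    then have "subgroup (H \<inter> G i) (add_monoid R\<lparr>carrier := H\<rparr>)"
      using add.subgroup_incl[OF _ subring.axioms(1)[OF H]] by simp
    then show ?thesis
      by (simp add: additive_subgroup_def)
  qed
  show ?thesis
  proof
    show "internal_direct_sum (R\<lparr>carrier := H\<rparr>) (\<lambda>i. H \<inter> G i) (carrier (R\<lparr>carrier := H\<rparr>))"
      using graded subgroup by (simp add: internal_direct_sum_def components)
    show "\<one>\<^bsub>R\<lparr>carrier := H\<rparr>\<^esub> \<in> H \<inter> G 0"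
      using one_graded subringE(3)[OF H] by simp
    show "x \<otimes>\<^bsub>R\<lparr>carrier := H\<rparr>\<^esub> y \<in> H \<inter> G (i + j)" if "x \<in> H \<inter> G i" "y \<in> H \<inter> G j" for x y i j
      using that mult_graded subringE(6)[OF H] by simp
  qed
qed

section \<open>Homogeneous additive maps\<close>

locale homogeneous_map = graded_ring +
  fixes \<phi> and j :: int
  assumes map_closed: "x \<in> carrier R \<Longrightarrow> \<phi> x \<in> carrier R"
    and map_add: "x \<in> carrier R \<Longrightarrow> y \<in> carrier R \<Longrightarrow> \<phi> (x \<oplus> y) = \<phi> x \<oplus> \<phi> y"
    and map_degree: "x \<in> G i \<Longrightarrow> \<phi> x \<in> G (i + j)"
begin

lemma map_hom: "abelian_group_hom R R \<phi>"
  using map_closed map_add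
  by (intro abelian_group_homI group_hom.intro group_hom_axioms.intro)
    (auto simp: hom_def intro: abelian_group_axioms add.is_group)

lemma map_zero: "\<phi> \<zero> = \<zero>"
  using abelian_group_hom.hom_zero[OF map_hom] .

lemma map_finsum:
  assumes "finite S" "\<And>i. i \<in> S \<Longrightarrow> f i \<in> carrier R"
  shows "\<phi> (\<Oplus>i\<in>S. f i) = (\<Oplus>i\<in>S. \<phi> (f i))"
  using assms
proof induction
  case empty
  then show ?case by (simp add: map_zero)
next
  case (insert i S)
  have "(\<Oplus>k\<in>insert i S. f k) = f i \<oplus> (\<Oplus>k\<in>S. f k)"
    using insert by (intro finsum_insert) auto
  moreover have "(\<Oplus>k\<in>insert i S. \<phi> (f k)) = \<phi> (f i) \<oplus> (\<Oplus>k\<in>S. \<phi> (f k))"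
    using insert map_closed by (intro finsum_insert) auto
  moreover have "(\<Oplus>k\<in>S. f k) \<in> carrier R"
    using insert by (intro finsum_closed) auto
  ultimately show ?case
    using insert map_add by simp
qed

lemma components_map:
  assumes a: "homogeneous_components R G a f"
  shows "homogeneous_components R G (\<phi> a) (\<lambda>k. \<phi> (f (k - j)))"
proof -
  define S where "S = {i. f i \<noteq> \<zero>}"
  define T where "T = {k. \<phi> (f (k - j)) \<noteq> \<zero>}"
  have f: "f i \<in> G i" "f i \<in> carrier R" for i
    using a graded_part_closed by (auto simp: homogeneous_components_def)
  have S: "finite S" and a_sum: "a = (\<Oplus>i\<in>S. f i)"
    using a by (simp_all add: homogeneous_components_def S_def)
  have T: "T \<subseteq> (\<lambda>i. i + j) ` S"
  proof
    fix k assume "k \<in> T"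
    then have "k - j \<in> S"
      using map_zero by (auto simp: S_def T_def)
    then show "k \<in> (\<lambda>i. i + j) ` S"
      by (rule rev_image_eqI) simp
  qed
  have "\<phi> a = (\<Oplus>i\<in>S. \<phi> (f i))"
    using map_finsum S f a_sum by blast
  also have "\<dots> = (\<Oplus>k\<in>(\<lambda>i. i + j) ` S. \<phi> (f (k - j)))"
    using f map_closed by (subst finsum_reindex) (auto simp: inj_on_def)
  also have "\<dots> = (\<Oplus>k\<in>T. \<phi> (f (k - j)))"
    using S T f map_closed by (intro add.finprod_mono_neutral_cong_right) (auto simp: T_def)
  finally have "\<phi> a = (\<Oplus>k\<in>T. \<phi> (f (k - j)))" .
  moreover have "\<phi> (f (k - j)) \<in> G k" for k
    using map_degree[OF f(1), of "k - j"] by simp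
  moreover have "finite T"
    using S T finite_subset by blast
  ultimately show ?thesis
    by (simp add: homogeneous_components_def T_def)
qed

lemma kernel_graded: "internal_direct_sum R (\<lambda>i. a_kernel R R \<phi> \<inter> G i) (a_kernel R R \<phi>)"
proof (rule graded_subgroupI)
  show "additive_subgroup (a_kernel R R \<phi>) R"
    using abelian_group_hom.additive_subgroup_a_kernel[OF map_hom] .
  fix a assume "a \<in> a_kernel R R \<phi>"
  then have a: "a \<in> carrier R" "\<phi> a = \<zero>"
    by (simp_all add: a_kernel_def')
  obtain f where f: "homogeneous_components R G a f"
    using components_exist a(1) by blast
  have "(\<lambda>k. \<phi> (f (k - j))) = (\<lambda>k. \<zero>)"
    using components_map[OF f] components_zero a(2) by (intro components_unique[of \<zero>]) auto
  from fun_cong[OF this] have "\<phi> (f i) = \<zero>" for i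
    by (metis add_diff_cancel_right')
  moreover have "f i \<in> carrier R" for i
    using f graded_part_closed by (auto simp: homogeneous_components_def)
  ultimately show "\<exists>f. homogeneous_components R G a f \<and> (\<forall>i. f i \<in> a_kernel R R \<phi>)"
    using f by (auto simp: a_kernel_def')
qed

lemma image_subgroup: "additive_subgroup (\<phi> ` carrier R) R"
  using group_hom.img_is_subgroup[OF abelian_group_hom.a_group_hom[OF map_hom]]
  by (simp add: additive_subgroup_def)

lemma image_graded: "internal_direct_sum R (\<lambda>i. \<phi> ` carrier R \<inter> G i) (\<phi> ` carrier R)"
proof (rule graded_subgroupI[OF image_subgroup])
  fix b assume "b \<in> \<phi> ` carrier R"
  then obtain a where a: "a \<in> carrier R" "b = \<phi> a"
    by blast
  obtain f where f: "homogeneous_components R G a f"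
    using components_exist a(1) by blast
  have "f i \<in> carrier R" for i
    using f graded_part_closed by (auto simp: homogeneous_components_def)
  then show "\<exists>f. homogeneous_components R G b f \<and> (\<forall>i. f i \<in> \<phi> ` carrier R)"
    using components_map[OF f] a(2) by blast
qed

end

lemma (in graded_ring) right_mult_homogeneous_map:
  "x \<in> G j \<Longrightarrow> homogeneous_map R G (\<lambda>a. a \<otimes> x) j"
  using mult_graded graded_part_closed
  by unfold_locales (auto simp: l_distr)

lemma (in graded_ring) left_mult_homogeneous_map:
  "x \<in> G j \<Longrightarrow> homogeneous_map R G (\<lambda>a. x \<otimes> a) j"
  using mult_graded[of x j] graded_part_closed
  by unfold_locales (auto simp: r_distr add.commute)

section \<open>Cycles\<close>

context dg_algebra
begin

lemma diff_homogeneous_map: "homogeneous_map A G d 1"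
  using diff_closed diff_add diff_degree by unfold_locales auto

lemma diff_zero: "d \<zero> = \<zero>"
  by (rule homogeneous_map.map_zero[OF diff_homogeneous_map])

lemma mem_cycles_iff: "x \<in> a_kernel A A d \<longleftrightarrow> x \<in> carrier A \<and> d x = \<zero>"
  by (auto simp: a_kernel_def')

text \<open>For \<open>\<one> \<otimes> \<one>\<close> the Leibniz rule reads \<open>d \<one> = d \<one> \<oplus> d \<one>\<close>.\<close>

lemma diff_one: "d \<one> = \<zero>"
  using diff_mult[OF one_graded one_graded] diff_closed[OF one_closed]
  by (simp add: add.l_cancel_one')

text \<open>Only the term \<open>a \<otimes> d x\<close> of the Leibniz rule has a sign depending on degrees, and it vanishes
  here. Hence the formula is additive in both factors and extends from homogeneous elements, with
  components of the cycle \<open>x\<close> that are themselves cycles.\<close>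

lemma diff_mult_cycle_right:
  assumes "a \<in> carrier A" and "x \<in> a_kernel A A d"
  shows "d (a \<otimes> x) = d a \<otimes> x"
proof -
  have leibniz: "d (a \<otimes> x) = d a \<otimes> x" if a: "a \<in> carrier A" and x: "x \<in> G j" "d x = \<zero>" for a x j
    using a
  proof (induction rule: homogeneous_induct)
    case zero
    then show ?case using x graded_part_closed by (simp add: diff_zero)
  next
    case (add y z)
    then show ?case
      using graded_part_closed[OF x(1)] diff_closed by (simp add: l_distr diff_add)
  next
    case (homogeneous i y)
    then have "y \<in> carrier A" "d y \<in> carrier A"
      using graded_part_closed diff_closed by auto
    then show ?case
      using graded_part_closed[OF x(1)] diff_mult[OF homogeneous x(1)] x(2) by simp
  qed
  obtain f where f: "homogeneous_components A (\<lambda>i. a_kernel A A d \<inter> G i) x f"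
    using homogeneous_map.kernel_graded[OF diff_homogeneous_map] assms(2)
    unfolding internal_direct_sum_def by blast
  then have cycle: "f i \<in> G i" "d (f i) = \<zero>" for i
    by (auto simp: homogeneous_components_def mem_cycles_iff)
  have "homogeneous_components A G x f"
    using f by (auto simp: homogeneous_components_def)
  then show ?thesis
  proof (induction rule: components_induct)
    case zero
    then show ?case using assms(1) by (simp add: diff_zero diff_closed)
  next
    case (add y z)
    then show ?case using assms(1) by (simp add: r_distr diff_add diff_closed)
  next
    case (component i)
    then show ?case using leibniz[OF assms(1) cycle] .
  qed
qed

text \<open>Here the sign is constant because the degree of the left factor is fixed, so that both sides
  are additive in \<open>a\<close>.\<close>

lemma diff_mult_cycle_left:
  assumes "a \<in> carrier A" and x: "x \<in> G i" "d x = \<zero>"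
  shows "d (x \<otimes> a) = (if even i then x \<otimes> d a else \<ominus> (x \<otimes> d a))"
  using assms(1)
proof (induction rule: homogeneous_induct)
  case zero
  then show ?case using graded_part_closed[OF x(1)] by (simp add: diff_zero)
next
  case (add y z)
  then show ?case
    using graded_part_closed[OF x(1)] diff_closed by (simp add: r_distr diff_add minus_add)
next
  case (homogeneous j y)
  then have "y \<in> carrier A" "d y \<in> carrier A"
    using graded_part_closed diff_closed by auto
  then show ?case
    using graded_part_closed[OF x(1)] diff_mult[OF x(1) homogeneous] x(2) by simp
qed

lemma cycles_subring: "subring (a_kernel A A d) A"
proof (rule subringI)
  interpret d: abelian_group_hom A A d
    by (rule homogeneous_map.map_hom[OF diff_homogeneous_map])
  show "a_kernel A A d \<subseteq> carrier A"
    by (auto simp: mem_cycles_iff)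
  show "\<one> \<in> a_kernel A A d"
    by (simp add: mem_cycles_iff diff_one)
  show "\<ominus> x \<in> a_kernel A A d" if "x \<in> a_kernel A A d" for x
    using that by (simp add: mem_cycles_iff)
  show "x \<otimes> y \<in> a_kernel A A d" if "x \<in> a_kernel A A d" "y \<in> a_kernel A A d" for x y
    using that diff_mult_cycle_right[of x y] by (simp add: mem_cycles_iff)
  show "x \<oplus> y \<in> a_kernel A A d" if "x \<in> a_kernel A A d" "y \<in> a_kernel A A d" for x y
    using that by (simp add: mem_cycles_iff)
qed

lemma cycles_graded_ring: "graded_ring (kernel_ring A d) (\<lambda>i. a_kernel A A d \<inter> G i)"
  using graded_subring[OF cycles_subring homogeneous_map.kernel_graded[OF diff_homogeneous_map]] .

text \<open>Multiplication by a homogeneous cycle \<open>x\<close>, from either side, commutes with \<open>d\<close> up to a sign,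
  hence its image is stable under \<open>d\<close>.\<close>

lemma dg_left_ideal_principal:
  assumes x: "x \<in> G i" "d x = \<zero>"
  shows "dg_left_ideal A G d ((\<lambda>a. a \<otimes> x) ` carrier A)"
proof -
  interpret x: homogeneous_map A G "\<lambda>a. a \<otimes> x" i
    by (rule right_mult_homogeneous_map[OF x(1)])
  have xA: "x \<in> carrier A"
    using graded_part_closed x(1) .
  have "b \<otimes> (a \<otimes> x) \<in> (\<lambda>a. a \<otimes> x) ` carrier A" if "a \<in> carrier A" "b \<in> carrier A" for a b
    using that xA by (intro image_eqI[of _ _ "b \<otimes> a"]) (auto simp: m_assoc)
  moreover have "d (a \<otimes> x) \<in> (\<lambda>a. a \<otimes> x) ` carrier A" if "a \<in> carrier A" for a
    using that diff_mult_cycle_right[OF that, of x] x xA diff_closed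
    by (auto simp: mem_cycles_iff)
  ultimately show ?thesis
    unfolding dg_left_ideal_def using x.image_subgroup x.image_graded by auto
qed

lemma dg_right_ideal_principal:
  assumes x: "x \<in> G i" "d x = \<zero>"
  shows "dg_right_ideal A G d ((\<lambda>a. x \<otimes> a) ` carrier A)"
proof -
  interpret x: homogeneous_map A G "\<lambda>a. x \<otimes> a" i
    by (rule left_mult_homogeneous_map[OF x(1)])
  have xA: "x \<in> carrier A"
    using graded_part_closed x(1) .
  have "(x \<otimes> a) \<otimes> b \<in> (\<lambda>a. x \<otimes> a) ` carrier A" if "a \<in> carrier A" "b \<in> carrier A" for a b
    using that xA by (intro image_eqI[of _ _ "a \<otimes> b"]) (auto simp: m_assoc)
  moreover have "d (x \<otimes> a) \<in> (\<lambda>a. x \<otimes> a) ` carrier A" if "a \<in> carrier A" for a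
  proof (rule image_eqI)
    show "d (x \<otimes> a) = x \<otimes> (if even i then d a else \<ominus> d a)"
      using diff_mult_cycle_left[OF that x] that xA diff_closed by (simp add: r_minus)
    show "(if even i then d a else \<ominus> d a) \<in> carrier A"
      using that diff_closed by simp
  qed
  ultimately show ?thesis
    unfolding dg_right_ideal_def using x.image_subgroup x.image_graded by auto
qed

lemma inverse_of_cycle_is_cycle:
  assumes x: "x \<in> a_kernel A A d" and y: "y \<in> carrier A" "y \<otimes> x = \<one>" "x \<otimes> y = \<one>"
  shows "y \<in> a_kernel A A d"
proof -
  have xA: "x \<in> carrier A"
    using x by (simp add: mem_cycles_iff)
  have "d y = d y \<otimes> (x \<otimes> y)"
    using y diff_closed by simp
  also have "\<dots> = d (y \<otimes> x) \<otimes> y"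
    using diff_mult_cycle_right[OF y(1) x] y(1) xA diff_closed by (simp add: m_assoc)
  also have "\<dots> = \<zero>"
    using y by (simp add: diff_one)
  finally show ?thesis
    using y(1) by (simp add: mem_cycles_iff)
qed

text \<open>A nonzero homogeneous \<open>x \<in> I\<close> is a cycle, or else \<open>d x\<close> is a nonzero one.\<close>

lemma dg_ideal_contains_homogeneous_cycle:
  assumes I: "internal_direct_sum A (\<lambda>i. I \<inter> G i) I" "additive_subgroup I A" "d ` I \<subseteq> I"
    and "I \<noteq> {\<zero>}"
  obtains z i where "z \<in> I" "z \<in> a_kernel A A d \<inter> G i" "z \<noteq> \<zero>"
proof -
  obtain x i where x: "x \<in> I" "x \<in> G i" "x \<noteq> \<zero>"
    using graded_subgroup_nonzero_homogeneous[OF I(1) assms(4)] additive_subgroup.zero_closed[OF I(2)]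
    by blast
  have xA: "x \<in> carrier A"
    using graded_part_closed x(2) .
  show thesis
  proof (cases "d x = \<zero>")
    case True
    then show thesis using that x xA by (auto simp: mem_cycles_iff)
  next
    case False
    have "d x \<in> a_kernel A A d \<inter> G (i + 1)"
      using diff_degree[OF x(2)] diff_closed[OF xA] diff_diff[OF xA] by (simp add: mem_cycles_iff)
    then show thesis using that False I(3) x(1) by blast
  qed
qed

section \<open>Units and ideals\<close>

text \<open>The left ideal \<open>A x\<close> gives a left inverse and the right ideal \<open>x A\<close> a right inverse of \<open>x\<close>.\<close>

lemma homogeneous_cycles_units_if_simple:
  assumes left: "\<And>I. dg_left_ideal A G d I \<Longrightarrow> I = {\<zero>} \<or> I = carrier A"
    and right: "\<And>I. dg_right_ideal A G d I \<Longrightarrow> I = {\<zero>} \<or> I = carrier A"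
    and x: "x \<in> a_kernel A A d \<inter> G i" "x \<noteq> \<zero>"
  shows "x \<in> Units (kernel_ring A d)"
proof -
  have xA: "x \<in> carrier A" and hom: "x \<in> G i" "d x = \<zero>"
    using x(1) by (auto simp: mem_cycles_iff)
  have "\<one> \<otimes> x \<in> (\<lambda>a. a \<otimes> x) ` carrier A" "x \<otimes> \<one> \<in> (\<lambda>a. x \<otimes> a) ` carrier A"
    by (intro imageI one_closed)+
  then have "(\<lambda>a. a \<otimes> x) ` carrier A \<noteq> {\<zero>}" "(\<lambda>a. x \<otimes> a) ` carrier A \<noteq> {\<zero>}"
    unfolding l_one[OF xA] r_one[OF xA] using x(2) by blast+
  then have all: "(\<lambda>a. a \<otimes> x) ` carrier A = carrier A" "(\<lambda>a. x \<otimes> a) ` carrier A = carrier A"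
    using left[OF dg_left_ideal_principal[OF hom]] right[OF dg_right_ideal_principal[OF hom]]
    by blast+
  have "\<one> \<in> (\<lambda>a. a \<otimes> x) ` carrier A"
    unfolding all(1) by (rule one_closed)
  then obtain y where y: "y \<in> carrier A" "y \<otimes> x = \<one>"
    by (metis imageE)
  have "\<one> \<in> (\<lambda>a. x \<otimes> a) ` carrier A"
    unfolding all(2) by (rule one_closed)
  then obtain y' where y': "y' \<in> carrier A" "x \<otimes> y' = \<one>"
    by (metis imageE)
  have "y = y'"
    using inv_unique[OF y(2) y'(2) xA y(1) y'(1)] .
  then have "y \<in> a_kernel A A d"
    using inverse_of_cycle_is_cycle y y'(2) x(1) by blast
  moreover have "x \<otimes> y = \<one>"
    using \<open>y = y'\<close> y'(2) by (rule ssubst)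
  ultimately show ?thesis
    using x(1) y(2) unfolding Units_def by auto
qed

lemma homogeneous_cycle_in_Units:
  assumes div: "graded_division_ring (kernel_ring A d) (\<lambda>i. a_kernel A A d \<inter> G i)"
    and "z \<in> a_kernel A A d \<inter> G i" "z \<noteq> \<zero>"
  obtains y where "y \<in> carrier A" "y \<otimes> z = \<one>" "z \<otimes> y = \<one>"
proof -
  have "z \<in> Units (kernel_ring A d)"
    using graded_division_ring.homogeneous_Units[OF div assms(2)] assms(3) by simp
  then show thesis
    using that by (auto simp: Units_def mem_cycles_iff)
qed

lemma dg_left_ideal_trivial:
  assumes div: "graded_division_ring (kernel_ring A d) (\<lambda>i. a_kernel A A d \<inter> G i)"
    and I: "dg_left_ideal A G d I" and nonzero: "I \<noteq> {\<zero>}"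
  shows "I = carrier A"
proof -
  have sub: "additive_subgroup I A" and mult: "\<And>a x. a \<in> carrier A \<Longrightarrow> x \<in> I \<Longrightarrow> a \<otimes> x \<in> I"
    using I unfolding dg_left_ideal_def by blast+
  obtain z i where z: "z \<in> I" "z \<in> a_kernel A A d \<inter> G i" "z \<noteq> \<zero>"
    using dg_ideal_contains_homogeneous_cycle[of I] I nonzero unfolding dg_left_ideal_def by blast
  obtain y where y: "y \<in> carrier A" "y \<otimes> z = \<one>"
    using homogeneous_cycle_in_Units[OF div z(2,3)] by blast
  have "a \<in> I" if "a \<in> carrier A" for a
    using mult[OF that mult[OF y(1) z(1)]] y(2) that by simp
  then show ?thesis
    using additive_subgroup.a_subset[OF sub] by blast
qed

lemma dg_right_ideal_trivial:
  assumes div: "graded_division_ring (kernel_ring A d) (\<lambda>i. a_kernel A A d \<inter> G i)"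
    and I: "dg_right_ideal A G d I" and nonzero: "I \<noteq> {\<zero>}"
  shows "I = carrier A"
proof -
  have sub: "additive_subgroup I A" and mult: "\<And>a x. a \<in> carrier A \<Longrightarrow> x \<in> I \<Longrightarrow> x \<otimes> a \<in> I"
    using I unfolding dg_right_ideal_def by blast+
  obtain z i where z: "z \<in> I" "z \<in> a_kernel A A d \<inter> G i" "z \<noteq> \<zero>"
    using dg_ideal_contains_homogeneous_cycle[of I] I nonzero unfolding dg_right_ideal_def by blast
  obtain y where y: "y \<in> carrier A" "z \<otimes> y = \<one>"
    using homogeneous_cycle_in_Units[OF div z(2,3)] by blast
  have "a \<in> I" if "a \<in> carrier A" for a
    using mult[OF that mult[OF y(1) z(1)]] y(2) that by simp
  then show ?thesis
    using additive_subgroup.a_subset[OF sub] by blast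
qed

text \<open>Both sides amount to \<open>\<one> \<noteq> \<zero>\<close>, as \<open>\<one>\<close> is a cycle.\<close>

lemma cycles_nonzero_iff: "a_kernel A A d \<noteq> {\<zero>} \<longleftrightarrow> carrier A \<noteq> {\<zero>}"
proof -
  have "\<one> \<in> a_kernel A A d" "\<zero> \<in> a_kernel A A d" "a_kernel A A d \<subseteq> carrier A"
    by (auto simp: mem_cycles_iff diff_one diff_zero)
  then show ?thesis
    using carrier_one_zero by blast
qed

end

theorem lemma1p4:
  fixes K :: "('k, 'm) ring_scheme" and A :: "('k, 'a, 'n) module_scheme"
    and G :: "int \<Rightarrow> 'a set" and d :: "'a \<Rightarrow> 'a"
  assumes "dg_algebra K A G d"
  shows "dg_division_algebra K A G d \<longleftrightarrow>
    graded_division_ring (kernel_ring A d) (\<lambda>i. a_kernel A A d \<inter> G i)"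
proof -
  interpret dg_algebra K A G d by fact
  show ?thesis
  proof
    assume "dg_division_algebra K A G d"
    then interpret D: dg_division_algebra K A G d .
    show "graded_division_ring (kernel_ring A d) (\<lambda>i. a_kernel A A d \<inter> G i)"
    proof (intro graded_division_ring.intro graded_division_ring_axioms.intro)
      show "graded_ring (kernel_ring A d) (\<lambda>i. a_kernel A A d \<inter> G i)"
        by (rule cycles_graded_ring)
      show "carrier (kernel_ring A d) \<noteq> {\<zero>\<^bsub>kernel_ring A d\<^esub>}"
        using cycles_nonzero_iff D.nonzero by simp
      show "x \<in> Units (kernel_ring A d)"
        if "x \<in> a_kernel A A d \<inter> G i" "x \<noteq> \<zero>\<^bsub>kernel_ring A d\<^esub>" for x i
        using homogeneous_cycles_units_if_simple[OF D.dg_left_ideals D.dg_right_ideals] that by simp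
    qed
  next
    assume div: "graded_division_ring (kernel_ring A d) (\<lambda>i. a_kernel A A d \<inter> G i)"
    show "dg_division_algebra K A G d"
    proof (intro dg_division_algebra.intro dg_division_algebra_axioms.intro)
      show "dg_algebra K A G d" by fact
      show "carrier A \<noteq> {\<zero>\<^bsub>A\<^esub>}"
        using cycles_nonzero_iff graded_division_ring.nonzero[OF div] by simp
      show "I = {\<zero>\<^bsub>A\<^esub>} \<or> I = carrier A" if "dg_left_ideal A G d I" for I
        using dg_left_ideal_trivial[OF div that] by blast
      show "I = {\<zero>\<^bsub>A\<^esub>} \<or> I = carrier A" if "dg_right_ideal A G d I" for I
        using dg_right_ideal_trivial[OF div that] by blast
    qed
  qed
qed

end
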